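(* Let $C_k=\frac1{k+1}\binom{2k}{k}$ denote the Catalan numbers, put $\gamma(k)=(2k)!/(4^{k}\,k!)$ for integers $k\ge0$, and define $$\Lambda_N(t)=\prod_{j=1}^{N-1}(t+j)_j\qquad(\Lambda_0=\Lambda_1=1).$$ Let $N\ge0$ and let $a,b$ be integers with $a\ge N-1$, $a\ge 0$ and $b\ge a+1$. Then $$\det\bigl(C_{a+r-m}\,C_{b+r+m}\bigr)_{0\le r,m\le N-1} =(-4)^{\binom N2}\,4^{\,N(a+b)}\,\prod_{k=1}^{N-1}(2k+1)!\;\cdot\; \frac{\displaystyle\prod_{k=0}^{N-1}\gamma(a-k)\,\gamma(b+k)} {\displaystyle\prod_{k=2}^{N+1}(a+k-1)!\;\prod_{k=N+1}^{2N}(b+k-1)!}\; \Lambda_N(b-a)\,\Lambda_N\bigl(a+b+\tfrac32\bigr).$$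
   Context: $(u)_j=u(u+1)\cdots(u+j-1)$ is the Pochhammer symbol; empty products and the determinant of the empty ($0\times0$) matrix equal $1$. *)

theory Defs
  imports Complex_Main "Jordan_Normal_Form.Determinant"
begin

definition catalan :: "nat \<Rightarrow> real" where
  "catalan k = 1 / (real k + 1) * real ((2 * k) choose k)"

definition gam :: "nat \<Rightarrow> real" where
  "gam k = fact (2 * k) / (4 ^ k * fact k)"

text \<open>The index set \<open>{1..<N}\<close> is empty for \<open>N = 0\<close> and for \<open>N = 1\<close>, so both values are 1.\<close>

definition Lam :: "nat \<Rightarrow> real \<Rightarrow> real" where
  "Lam N t = (\<Prod>j\<in>{1..<N}. pochhammer (t + real j) j)"

text \<open>The subtraction \<open>a + r - m\<close> is on natural numbers; it never truncates
  when \<open>m < N\<close> and \<open>N \<le> a + 1\<close>.\<close>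

definition catalan_mat :: "nat \<Rightarrow> nat \<Rightarrow> nat \<Rightarrow> real mat" where
  "catalan_mat N a b = mat N N (\<lambda>(r, m). catalan (a + r - m) * catalan (b + r + m))"

end

theory Submission
  imports Defs
begin

text \<open>Since \<open>catalan n = 4 ^ n * gam n / fact (n + 1)\<close>, extracting from row \<open>r\<close> and column \<open>m\<close>
  the obvious powers of 4, gamma factors and factorials leaves products of factors
  \<open>(a - m + w) * (b + m + w)\<close>. As \<open>(a - m) + (b + m)\<close> does not depend on \<open>m\<close>, such a factor equals
  \<open>X m + w * (a + b + w)\<close> with \<open>X m = (a - m) * (b + m)\<close>. Row \<open>r\<close> contains
  \<open>w = i + 1 / 2\<close> for \<open>i < r\<close> and \<open>w = i + 1\<close> for \<open>r < i < N\<close>, so Krattenthaler's determinant lemma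
  applies, and the differences in its product formula factor linearly.\<close>

section \<open>Determinants of matrices of linear-factor products\<close>

text \<open>A monic polynomial expands in the Newton basis at arbitrary nodes \<open>y\<close>, with
  leading coefficient 1. Since \<open>c\<close> does not depend on \<open>x\<close>, evaluating at
  many points turns the expansion into a matrix factorization.\<close>

lemma newton_expansion:
  fixes a y :: "nat \<Rightarrow> 'a :: comm_ring_1"
  obtains c where "c n = 1"
    and "\<And>x. (\<Prod>i<n. x + a i) = (\<Sum>j\<le>n. c j * (\<Prod>i<j. x - y i))"
proof -
  have "\<exists>c. c n = 1 \<and> (\<forall>x. (\<Prod>i<n. x + a i) = (\<Sum>j\<le>n. c j * (\<Prod>i<j. x - y i)))"
  proof (induction n)
    case 0
    show ?case by (intro exI[of _ "\<lambda>_. 1"]) simp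
  next
    case (Suc n)
    then obtain c where c: "c n = 1"
      "\<And>x. (\<Prod>i<n. x + a i) = (\<Sum>j\<le>n. c j * (\<Prod>i<j. x - y i))"
      by blast
    \<comment> \<open>Splitting \<open>x + a n\<close> as \<open>(x - y j) + (y j + a n)\<close>
      sends the \<open>j\<close>-th term to index \<open>j + 1\<close> and to index
      \<open>j\<close>. The guards cut off both ends, as \<open>c\<close> is unconstrained beyond
      \<open>n\<close>.\<close>
    define d where "d j = (if j = 0 then 0 else c (j - 1)) +
      (if j \<le> n then (y j + a n) * c j else 0)" for j
    have "(\<Prod>i<Suc n. x + a i) = (\<Sum>j\<le>Suc n. d j * (\<Prod>i<j. x - y i))" for x
    proof -
      let ?h = "\<lambda>j. \<Prod>i<j. x - y i"
      have "(\<Prod>i<Suc n. x + a i) = (\<Sum>j\<le>n. c j * ?h j * (x + a n))"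
        by (simp add: c(2) sum_distrib_right)
      also have "\<dots> = (\<Sum>j\<le>n. c j * ?h (Suc j) + (y j + a n) * c j * ?h j)"
        by (intro sum.cong) (simp_all add: algebra_simps)
      also have "\<dots> = (\<Sum>j\<le>n. c j * ?h (Suc j)) + (\<Sum>j\<le>n. (y j + a n) * c j * ?h j)"
        by (rule sum.distrib)
      also have "(\<Sum>j\<le>n. c j * ?h (Suc j)) =
          (\<Sum>j\<le>Suc n. (if j = 0 then 0 else c (j - 1)) * ?h j)"
        by (simp add: sum.atMost_Suc_shift del: sum.atMost_Suc prod.lessThan_Suc)
      also have "(\<Sum>j\<le>n. (y j + a n) * c j * ?h j) =
          (\<Sum>j\<le>Suc n. (if j \<le> n then (y j + a n) * c j else 0) * ?h j)"
        by simp
      finally show ?thesis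
        by (simp only: d_def distrib_right sum.distrib)
    qed
    moreover have "d (Suc n) = 1"
      by (simp add: d_def c)
    ultimately show ?case by blast
  qed
  then show thesis using that by blast
qed

text \<open>Taking the values \<open>X i\<close> themselves as Newton nodes factors the matrix into
  a unit lower triangular one, which absorbs \<open>B\<close>, and an upper triangular one, whose
  diagonal yields the Vandermonde product.\<close>

lemma det_monic_products:
  fixes X B :: "nat \<Rightarrow> 'a :: comm_ring_1"
  shows "det (mat N N (\<lambda>(r, m). \<Prod>i<r. X m + B i)) = (\<Prod>j<N. \<Prod>i<j. X j - X i)"
proof -
  have "\<forall>r. \<exists>c. c r = 1 \<and>
      (\<forall>x. (\<Prod>i<r. x + B i) = (\<Sum>j\<le>r. c j * (\<Prod>i<j. x - X i)))"
    by (metis newton_expansion)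
  then obtain c where c: "\<And>r. c r r = 1"
    "\<And>r x. (\<Prod>i<r. x + B i) = (\<Sum>j\<le>r. c r j * (\<Prod>i<j. x - X i))"
    by metis
  define C where "C = mat N N (\<lambda>(r, k). if k \<le> r then c r k else 0)"
  define H where "H = mat N N (\<lambda>(k, m). \<Prod>i<k. X m - X i)"
  have CH: "C \<in> carrier_mat N N" "H \<in> carrier_mat N N"
    by (simp_all add: C_def H_def)
  have "mat N N (\<lambda>(r, m). \<Prod>i<r. X m + B i) = C * H"
  proof (rule eq_matI)
    fix r m assume "r < dim_row (C * H)" "m < dim_col (C * H)"
    then have rm: "r < N" "m < N" using CH by auto
    have "(C * H) $$ (r, m) = (\<Sum>k<N. (if k \<le> r then c r k else 0) * (\<Prod>i<k. X m - X i))"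
      using rm by (simp add: C_def H_def scalar_prod_def atLeast0LessThan)
    also have "\<dots> = (\<Sum>k\<le>r. c r k * (\<Prod>i<k. X m - X i))"
      using rm by (intro sum.mono_neutral_cong_right) auto
    finally show "mat N N (\<lambda>(r, m). \<Prod>i<r. X m + B i) $$ (r, m) = (C * H) $$ (r, m)"
      using rm by (simp add: c(2))
  qed (use CH in auto)
  moreover have "det C = 1"
    by (subst det_lower_triangular[OF _ CH(1)]) (auto simp: C_def prod_list_diag_prod c)
  moreover have "det H = (\<Prod>j<N. \<Prod>i<j. X j - X i)"
  proof (subst det_upper_triangular[OF _ CH(2)])
    \<comment> \<open>Below the diagonal, where \<open>m < k\<close>, the product contains the
      factor \<open>X m - X m\<close>.\<close>
    show "upper_triangular H"
      by (rule upper_triangularI) (auto simp: H_def intro!: prod_zero)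
    show "prod_list (diag_mat H) = (\<Prod>j<N. \<Prod>i<j. X j - X i)"
      by (auto simp: H_def prod_list_diag_prod atLeast0LessThan)
  qed
  ultimately show ?thesis using det_mult[OF CH] by simp
qed

text \<open>Krattenthaler's determinant lemma. In the basis of the products \<open>\<Prod>i<k. x + B i\<close> the rows are
  upper triangular, since row \<open>r\<close> is divisible by the \<open>r\<close>-th basis element; the diagonal
  entries are the cofactors evaluated at \<open>- B r\<close>.\<close>

lemma det_krattenthaler:
  fixes X A B :: "nat \<Rightarrow> 'a :: comm_ring_1"
  shows "det (mat N N (\<lambda>(r, m). (\<Prod>i<r. X m + B i) * (\<Prod>i\<in>{r<..<N}. X m + A i))) =
    (\<Prod>j<N. \<Prod>i<j. (X j - X i) * (A j - B i))"
proof -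
  \<comment> \<open>The nodes start at \<open>- B r\<close>, so that multiplying by the first
    \<open>r\<close> factors of the row continues the product to the basis element of index
    \<open>r + j\<close>.\<close>
  have "\<forall>r. \<exists>c. \<forall>x. (\<Prod>i<N - Suc r. x + A (Suc r + i)) =
      (\<Sum>j\<le>N - Suc r. c j * (\<Prod>i<j. x - (- B (r + i))))"
    by (metis newton_expansion)
  then obtain c where c: "\<And>r x. (\<Prod>i<N - Suc r. x + A (Suc r + i)) =
      (\<Sum>j\<le>N - Suc r. c r j * (\<Prod>i<j. x + B (r + i)))"
    unfolding diff_minus_eq_add by metis
  have tail: "(\<Prod>i\<in>{r<..<N}. x + A i) =
      (\<Sum>j\<le>N - Suc r. c r j * (\<Prod>i<j. x + B (r + i)))" for r x
    unfolding c[symmetric]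
    by (rule prod.reindex_bij_witness[of _ "\<lambda>i. Suc r + i" "\<lambda>i. i - Suc r"]) auto
  have c0: "c r 0 = (\<Prod>i\<in>{r<..<N}. A i - B r)" for r
  proof -
    \<comment> \<open>At \<open>x = - B r\<close> every basis product with \<open>j > 0\<close>
      vanishes through its factor \<open>i = 0\<close>.\<close>
    have "(\<Prod>i\<in>{r<..<N}. - B r + A i) =
        (\<Sum>j\<in>{0}. c r j * (\<Prod>i<j. - B r + B (r + i)))"
      unfolding tail
    proof (rule sum.mono_neutral_right)
      show "\<forall>j\<in>{..N - Suc r} - {0}. c r j * (\<Prod>i<j. - B r + B (r + i)) = 0"
      proof
        fix j assume "j \<in> {..N - Suc r} - {0}"
        then have "(\<Prod>i<j. - B r + B (r + i)) = 0"
          by (intro prod_zero bexI[of _ 0]) auto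
        then show "c r j * (\<Prod>i<j. - B r + B (r + i)) = 0" by simp
      qed
    qed auto
    then show ?thesis by simp
  qed
  define C where "C = mat N N (\<lambda>(r, k). if r \<le> k then c r (k - r) else 0)"
  define G where "G = mat N N (\<lambda>(k, m). \<Prod>i<k. X m + B i)"
  let ?F = "mat N N (\<lambda>(r, m). (\<Prod>i<r. X m + B i) * (\<Prod>i\<in>{r<..<N}. X m + A i))"
  have CG: "C \<in> carrier_mat N N" "G \<in> carrier_mat N N"
    by (simp_all add: C_def G_def)
  have "?F = C * G"
  proof (rule eq_matI)
    fix r m assume "r < dim_row (C * G)" "m < dim_col (C * G)"
    then have rm: "r < N" "m < N" using CG by auto
    let ?g = "\<lambda>k. \<Prod>i<k. X m + B i"
    have g: "?g r * (\<Prod>i<j. X m + B (r + i)) = ?g (r + j)" for j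
      by (induction j) (simp_all add: mult.assoc[symmetric])
    have "(C * G) $$ (r, m) = (\<Sum>k<N. (if r \<le> k then c r (k - r) else 0) * ?g k)"
      using rm by (simp add: C_def G_def scalar_prod_def atLeast0LessThan)
    also have "\<dots> = (\<Sum>k\<in>{r..<N}. c r (k - r) * ?g k)"
      by (intro sum.mono_neutral_cong_right) auto
    \<comment> \<open>The cofactor has degree \<open>N - Suc r\<close>, so the indices
      \<open>r + j\<close> reach exactly \<open>N - 1\<close>.\<close>
    also have "\<dots> = (\<Sum>j\<le>N - Suc r. c r j * ?g (r + j))"
      by (rule sum.reindex_bij_witness[of _ "\<lambda>j. r + j" "\<lambda>k. k - r"]) (use rm in auto)
    also have "\<dots> = ?g r * (\<Prod>i\<in>{r<..<N}. X m + A i)"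
      unfolding tail sum_distrib_left g[symmetric] by (simp add: mult_ac)
    finally show "?F $$ (r, m) = (C * G) $$ (r, m)"
      using rm by simp
  qed (use CG in auto)
  moreover have "det C = (\<Prod>j<N. \<Prod>i<j. A j - B i)"
  proof (subst det_upper_triangular[OF _ CG(1)])
    show "upper_triangular C"
      by (rule upper_triangularI) (auto simp: C_def)
    have "prod_list (diag_mat C) = (\<Prod>r<N. \<Prod>i\<in>{i\<in>{..<N}. r < i}. A i - B r)"
      by (auto simp: C_def prod_list_diag_prod atLeast0LessThan c0 intro!: prod.cong)
    also have "\<dots> = (\<Prod>i<N. \<Prod>r\<in>{r\<in>{..<N}. r < i}. A i - B r)"
      by (rule prod.swap_restrict) auto
    also have "\<dots> = (\<Prod>j<N. \<Prod>i<j. A j - B i)"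
      by (intro prod.cong) auto
    finally show "prod_list (diag_mat C) = (\<Prod>j<N. \<Prod>i<j. A j - B i)" .
  qed
  ultimately show ?thesis
    using det_mult[OF CG] det_monic_products[of N X B]
    by (simp add: G_def prod.distrib mult.commute)
qed

text \<open>In the Leibniz formula each permutation meets every row and every column once, so all
  terms share the same factor.\<close>

lemma det_scale_rows_cols:
  fixes F :: "nat \<Rightarrow> nat \<Rightarrow> 'a :: comm_ring_1"
  shows "det (mat n n (\<lambda>(i, j). u i * v j * F i j)) =
    (\<Prod>i<n. u i) * (\<Prod>j<n. v j) * det (mat n n (\<lambda>(i, j). F i j))"
proof -
  have "(\<Prod>i = 0..<n. mat n n (\<lambda>(i, j). u i * v j * F i j) $$ (i, p i)) =
      (\<Prod>i<n. u i) * (\<Prod>j<n. v j) * (\<Prod>i = 0..<n. mat n n (\<lambda>(i, j). F i j) $$ (i, p i))"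
    if p: "p permutes {0..<n}" for p
  proof -
    have lt: "p i < n" if "i < n" for i
      using permutes_in_image[OF p, of i] that by simp
    have v: "(\<Prod>i = 0..<n. v (p i)) = (\<Prod>j<n. v j)"
      using prod.permute[OF p, of v] by (simp add: o_def atLeast0LessThan)
    have "(\<Prod>i = 0..<n. mat n n (\<lambda>(i, j). u i * v j * F i j) $$ (i, p i)) =
        (\<Prod>i = 0..<n. u i * v (p i) * F i (p i))"
      by (rule prod.cong) (simp_all add: lt)
    also have "\<dots> = (\<Prod>i<n. u i) * (\<Prod>j<n. v j) * (\<Prod>i = 0..<n. F i (p i))"
      by (simp add: prod.distrib v flip: atLeast0LessThan)
    also have "(\<Prod>i = 0..<n. F i (p i)) = (\<Prod>i = 0..<n. mat n n (\<lambda>(i, j). F i j) $$ (i, p i))"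
      by (rule prod.cong) (simp_all add: lt)
    finally show ?thesis .
  qed
  then show ?thesis
    by (subst (1 2) det_def'[of _ n]) (auto simp: sum_distrib_left mult_ac intro!: sum.cong)
qed

section \<open>Catalan numbers as products of linear factors\<close>

lemma gam_eq_pochhammer: "gam n = pochhammer (1 / 2) n"
  by (simp add: gam_def fact_double power_mult)

lemma catalan_eq_gam: "catalan n = 4 ^ n * gam n / fact (n + 1)"
proof -
  have "real (2 * n choose n) = fact (2 * n) / (fact n * fact n)"
    by (simp add: binomial_fact)
  then show ?thesis
    by (simp add: catalan_def gam_def)
qed

text \<open>Padding the factorial up to \<open>fact (n + N)\<close> makes the denominator
  independent of the row index \<open>r\<close>.\<close>

lemma fact_mult_prod_greaterThanLessThan:
  assumes "r < N"
  shows "fact (n + r + 1) * (\<Prod>i\<in>{r<..<N}. real n + (real i + 1)) = fact (n + N)"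
  using assms
proof (induction N)
  case (Suc N)
  show ?case
  proof (cases "r = N")
    case False
    then have "{r<..<Suc N} = insert N {r<..<N}" and "r < N" using Suc.prems by auto
    then show ?thesis using Suc.IH by (simp add: mult_ac)
  next
    case True
    then have "{r<..<Suc N} = {}" by auto
    then show ?thesis using True by simp
  qed
qed simp

text \<open>Half-integer shifts come from \<open>gam (n + r)\<close>, integer shifts from padding
  the factorial. Apart from the power of 4, the prefactor is free of \<open>r\<close> and can be
  pulled out of a column.\<close>

lemma catalan_add:
  assumes "r < N"
  shows "catalan (n + r) = 4 ^ (n + r) * (gam n / fact (n + N)) *
    ((\<Prod>i<r. real n + (real i + 1 / 2)) * (\<Prod>i\<in>{r<..<N}. real n + (real i + 1)))"
proof -
  have "gam (n + r) = gam n * (\<Prod>i<r. real n + (real i + 1 / 2))"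
    unfolding gam_eq_pochhammer pochhammer_product'
    by (simp add: pochhammer_prod atLeast0LessThan add_ac)
  moreover have "1 / fact (n + r + 1) =
      (\<Prod>i\<in>{r<..<N}. real n + (real i + 1)) / (fact (n + N) :: real)"
    using fact_mult_prod_greaterThanLessThan[OF assms, of n]
    by (intro frac_eq_eq[THEN iffD2] fact_nonzero) (simp only: mult_1_left mult.commute)
  ultimately show ?thesis
    by (simp only: catalan_eq_gam divide_inverse mult_1_left mult_ac)
qed

section \<open>Evaluation of the product of differences\<close>

text \<open>The induction step is
  \<open>(2 * j + 2) * (2 * j + 3) = 4 * (j + 1) * (j + 3 / 2)\<close>.\<close>

lemma fact_odd_eq_pochhammer:
  "fact (2 * j + 1) = (4 ^ j * fact j * pochhammer (3 / 2) j :: real)"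
  by (induction j) (simp_all add: pochhammer_Suc field_simps)

lemma prod_power_lessThan: "(\<Prod>j<N. (x :: 'a :: comm_monoid_mult) ^ j) = x ^ (N choose 2)"
  by (induction N) (simp_all add: numeral_2_eq_2 power_add mult.commute)

lemma Lam_eq: "Lam N t = (\<Prod>j<N. \<Prod>i<j. t + (real i + real j))"
proof -
  have "Lam N t = (\<Prod>j\<in>{1..<N}. \<Prod>i<j. t + (real i + real j))"
    by (simp add: Lam_def pochhammer_prod atLeast0LessThan algebra_simps)
  also have "\<dots> = (\<Prod>j<N. \<Prod>i<j. t + (real i + real j))"
    by (rule prod.mono_neutral_left) (auto simp: not_less_eq_eq)
  finally show ?thesis .
qed

text \<open>With \<open>s = a + b\<close>, the identity
  \<open>w * (s + w) - w' * (s + w') = (w - w') * (s + w + w')\<close> at \<open>w = j + 1\<close>,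
  \<open>w' = i + 1 / 2\<close> gives the shift \<open>3 / 2\<close>; the other difference is
  \<open>- (j - i) * (b - a + i + j)\<close>. The factors in \<open>i + j\<close> form the two
  \<open>Lam\<close> values, those in \<open>j - i\<close> the odd factorials.\<close>

lemma prod_differences:
  fixes a b :: real
  shows "(\<Prod>j<N. \<Prod>i<j. ((a - real j) * (b + real j) - (a - real i) * (b + real i)) *
      ((real j + 1) * (a + b + (real j + 1)) - (real i + 1 / 2) * (a + b + (real i + 1 / 2)))) =
    (- 1 / 4) ^ (N choose 2) * (\<Prod>k\<in>{1..<N}. fact (2 * k + 1)) *
    Lam N (b - a) * Lam N (a + b + 3 / 2)"
proof -
  have one: "(\<Prod>i<j. ((a - real j) * (b + real j) - (a - real i) * (b + real i)) *
      ((real j + 1) * (a + b + (real j + 1)) - (real i + 1 / 2) * (a + b + (real i + 1 / 2)))) =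
    (- 1 / 4) ^ j * fact (2 * j + 1) *
    (\<Prod>i<j. b - a + (real i + real j)) * (\<Prod>i<j. a + b + 3 / 2 + (real i + real j))" for j
  proof -
    have "(\<Prod>i<j. real j - real i) = (\<Prod>i<j. real (Suc i))"
      by (rule prod.reindex_bij_witness[of _ "\<lambda>i. j - Suc i" "\<lambda>i. j - Suc i"]) auto
    then have f: "(\<Prod>i<j. real j - real i) = fact j"
      by (simp only: fact_prod_Suc of_nat_prod atLeast0LessThan)
    \<comment> \<open>Reversing the order of the factors, \<open>i\<close> to
      \<open>j - 1 - i\<close>, turns \<open>j - i + 1 / 2\<close> into
      \<open>i + 3 / 2\<close>.\<close>
    have "(\<Prod>i<j. real j - real i + 1 / 2) = (\<Prod>i<j. 3 / 2 + real i)"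
      by (rule prod.reindex_bij_witness[of _ "\<lambda>i. j - Suc i" "\<lambda>i. j - Suc i"])
        (auto simp: of_nat_diff)
    then have h: "(\<Prod>i<j. real j - real i + 1 / 2) = pochhammer (3 / 2) j"
      by (simp add: pochhammer_prod atLeast0LessThan)
    have "(\<Prod>i<j. ((a - real j) * (b + real j) - (a - real i) * (b + real i)) *
        ((real j + 1) * (a + b + (real j + 1)) - (real i + 1 / 2) * (a + b + (real i + 1 / 2)))) =
      (\<Prod>i<j. (- 1) * (real j - real i) * (real j - real i + 1 / 2) *
        (b - a + (real i + real j)) * (a + b + 3 / 2 + (real i + real j)))"
    proof (rule prod.cong[OF refl])
      fix i
      have "(a - real j) * (b + real j) - (a - real i) * (b + real i) =
          (- 1) * (real j - real i) * (b - a + (real i + real j))"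
        by (simp add: algebra_simps)
      moreover have
        "(real j + 1) * (a + b + (real j + 1)) - (real i + 1 / 2) * (a + b + (real i + 1 / 2)) =
          (real j - real i + 1 / 2) * (a + b + 3 / 2 + (real i + real j))"
        by (simp add: field_simps)
      ultimately show "((a - real j) * (b + real j) - (a - real i) * (b + real i)) *
          ((real j + 1) * (a + b + (real j + 1)) - (real i + 1 / 2) * (a + b + (real i + 1 / 2))) =
        (- 1) * (real j - real i) * (real j - real i + 1 / 2) *
          (b - a + (real i + real j)) * (a + b + 3 / 2 + (real i + real j))"
        by (simp only: mult_ac)
    qed
    also have "\<dots> = (- 1) ^ j * (fact j * pochhammer (3 / 2) j) *
      (\<Prod>i<j. b - a + (real i + real j)) * (\<Prod>i<j. a + b + 3 / 2 + (real i + real j))"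
      unfolding prod.distrib f h by simp
    also have "(- 1) ^ j * (fact j * pochhammer (3 / 2) j) = (- 1 / 4 :: real) ^ j * fact (2 * j + 1)"
      unfolding fact_odd_eq_pochhammer by (simp flip: power_mult_distrib)
    finally show ?thesis .
  qed
  have "(\<Prod>j<N. fact (2 * j + 1)) = (\<Prod>k\<in>{1..<N}. fact (2 * k + 1) :: real)"
    by (rule prod.mono_neutral_right) (auto simp: not_less_eq_eq)
  then show ?thesis
    unfolding one unfolding prod.distrib prod_power_lessThan Lam_eq by (simp only:)
qed

section \<open>Extraction of row and column factors\<close>

theorem theorem18p8:
  fixes N a b :: nat
  assumes "int a \<ge> int N - 1" and "b \<ge> a + 1"
  shows "det (catalan_mat N a b) =
    (- 4) ^ (N choose 2) * 4 ^ (N * (a + b)) * (\<Prod>k\<in>{1..<N}. fact (2 * k + 1)) *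
    ((\<Prod>k\<in>{0..<N}. gam (a - k) * gam (b + k)) /
     ((\<Prod>k\<in>{2..N + 1}. fact (a + k - 1)) * (\<Prod>k\<in>{N + 1..2 * N}. fact (b + k - 1)))) *
    Lam N (real b - real a) * Lam N (real a + real b + 3 / 2)"
proof -
  \<comment> \<open>This bound gives \<open>m \<le> a\<close> for every column, so
    \<open>a - m\<close> is never truncated.\<close>
  have N: "N \<le> a + 1" using assms(1) by linarith
  let ?s = "real a + real b"
  define X where "X m = (real a - real m) * (real b + real m)" for m
  define A where "A i = (real i + 1) * (?s + (real i + 1))" for i
  define B where "B i = (real i + 1 / 2) * (?s + (real i + 1 / 2))" for i
  \<comment> \<open>The power of 4 in an entry is \<open>4 ^ (a - m + r) * 4 ^ (b + m + r)\<close>,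
    where \<open>m\<close> cancels; it therefore belongs to the row.\<close>
  define u where "u r = (4 :: real) ^ (a + b) * 16 ^ r" for r
  define v where
    "v m = gam (a - m) * gam (b + m) / (fact (a - m + N) * fact (b + m + N))" for m
  let ?K = "\<lambda>r m. (\<Prod>i<r. X m + B i) * (\<Prod>i\<in>{r<..<N}. X m + A i)"
  have entry: "catalan (a + r - m) * catalan (b + r + m) = u r * v m * ?K r m"
    if r: "r < N" and m: "m < N" for r m
  proof -
    have ma: "m \<le> a" using m N by linarith
    have split: "X m + w * (?s + w) = (real (a - m) + w) * (real (b + m) + w)" for w
      by (simp add: X_def of_nat_diff[OF ma] algebra_simps)
    have K: "?K r m =
      ((\<Prod>i<r. real (a - m) + (real i + 1 / 2)) * (\<Prod>i\<in>{r<..<N}. real (a - m) + (real i + 1))) *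
      ((\<Prod>i<r. real (b + m) + (real i + 1 / 2)) * (\<Prod>i\<in>{r<..<N}. real (b + m) + (real i + 1)))"
      unfolding A_def B_def split prod.distrib by (simp only: mult_ac)
    have pow: "(4 :: real) ^ (a - m + r) * 4 ^ (b + m + r) = u r"
    proof -
      have "a - m + r + (b + m + r) = a + b + 2 * r" using ma by linarith
      then have "(4 :: real) ^ (a - m + r) * 4 ^ (b + m + r) = 4 ^ (a + b + 2 * r)"
        by (simp only: power_add[symmetric])
      then show ?thesis by (simp add: u_def power_add power_mult)
    qed
    have "catalan (a + r - m) * catalan (b + r + m) =
        catalan (a - m + r) * catalan (b + m + r)"
      using ma by (simp add: add_ac)
    also have "\<dots> = u r * v m * ?K r m"
      unfolding catalan_add[OF r] K v_def pow[symmetric] by simp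
    finally show ?thesis .
  qed
  have "catalan_mat N a b = mat N N (\<lambda>(r, m). u r * v m * ?K r m)"
    unfolding catalan_mat_def by (rule eq_matI) (auto simp: entry)
  then have "det (catalan_mat N a b) = (\<Prod>r<N. u r) * (\<Prod>m<N. v m) *
      (\<Prod>j<N. \<Prod>i<j. (X j - X i) * (A j - B i))"
    by (simp only: det_scale_rows_cols det_krattenthaler)
  also have "(\<Prod>j<N. \<Prod>i<j. (X j - X i) * (A j - B i)) =
      (- 1 / 4) ^ (N choose 2) * (\<Prod>k\<in>{1..<N}. fact (2 * k + 1)) *
      Lam N (real b - real a) * Lam N (?s + 3 / 2)"
    unfolding X_def A_def B_def by (rule prod_differences)
  also have "(\<Prod>r<N. u r) = 16 ^ (N choose 2) * 4 ^ (N * (a + b))"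
    by (simp add: u_def prod.distrib prod_power_lessThan power_mult[symmetric] mult.commute)
  also have "(\<Prod>m<N. v m) = (\<Prod>k\<in>{0..<N}. gam (a - k) * gam (b + k)) /
     ((\<Prod>k\<in>{2..N + 1}. fact (a + k - 1)) * (\<Prod>k\<in>{N + 1..2 * N}. fact (b + k - 1)))"
  proof -
    \<comment> \<open>The substitution \<open>k = N + 1 - m\<close> reverses the order; the next
      product uses \<open>k = m + N + 1\<close>.\<close>
    have "(\<Prod>m<N. fact (a - m + N)) = (\<Prod>k\<in>{2..N + 1}. fact (a + k - 1) :: real)"
      by (rule prod.reindex_bij_witness[of _ "\<lambda>k. N + 1 - k" "\<lambda>m. N + 1 - m"]) (use N in auto)
    moreover have "(\<Prod>m<N. fact (b + m + N)) = (\<Prod>k\<in>{N + 1..2 * N}. fact (b + k - 1) :: real)"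
      by (rule prod.reindex_bij_witness[of _ "\<lambda>k. k - (N + 1)" "\<lambda>m. m + N + 1"])
        (auto simp: add_ac)
    ultimately show ?thesis
      by (simp add: v_def prod_dividef prod.distrib atLeast0LessThan)
  qed
  finally show ?thesis
    \<comment> \<open>The powers of 16 from the rows and of \<open>- 1 / 4\<close> from the
      differences combine to powers of \<open>- 4\<close>.\<close>
    using power_mult_distrib[of "16 :: real" "- 1 / 4" "N choose 2"] by (simp add: mult_ac)
qed

end
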